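(* For a positive integer $k\ge2$, let $u$ and $v$ be two vertices of a $k$-uniform hypergraph $\mathcal{H}$ with $d_{\mathcal{H}}(u)<d_{\mathcal{H}}(v)+s$, where $e_1,\dots,e_s$ are all the pendant hyperedges containing the vertex $u$. Let $\mathcal{H}'$ be the $k$-uniform hypergraph obtained from $\mathcal{H}$ by moving all the pendant hyperedges $e_1,\dots,e_s$ from $u$ to $v$ ($\mathcal{H}'$ is said to be a $\sigma$-transformation of $\mathcal{H}$). Then $\mathcal{H}\prec_\alpha\mathcal{H}'$ for $0<\alpha<1$.
   Context: Hypergraphs are finite; $k$-uniform means every hyperedge has exactly $k$ vertices; $d_{\mathcal{H}}(x)$ is the degree of $x$ in $\mathcal{H}$. A cored vertex is a vertex of degree one. A hyperedge is called a pendant hyperedge if it contains $k-1$ cored vertices. Moving $e_i$ from $u$ to $v$ means replacing $e_i$ by $(e_i\setminus\{u\})\cup\{v\}$, the vertex set being unchanged. For a $k$-uniform hypergraph $\mathcal{H}$ on $[n]$, $\mathcal{A}(\mathcal{H})$ is the $k$-order $n$-dimensional tensor with entry $\frac1{(k-1)!}$ at $(i_1,\dots,i_k)$ if $\{i_1,\dots,i_k\}\in E(\mathcal{H})$ and $0$ otherwise; $\mathcal{D}(\mathcal{H})$ is the diagonal tensor of vertex degrees; $\mathcal{A}_\alpha(\mathcal{H})=\alpha\mathcal{D}(\mathcal{H})+(1-\alpha)\mathcal{A}(\mathcal{H})$. For a tensor $\mathcal{T}$, $\mathrm{Tr}_d(\mathcal{T})$ is the sum of the $d$-th powers of all $n(k-1)^{n-1}$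 eigenvalues of $\mathcal{T}$; in particular $\mathrm{Tr}_0(\mathcal{T})=n(k-1)^{n-1}$, and for $d\ge1$ $$\mathrm{Tr}_{d}(\mathcal{T})=(k-1)^{n-1}\sum_{d_1+\cdots+d_n=d}\ \prod_{i=1}^{n}\frac{1}{(d_i(k-1))!}\Big(\sum_{\gamma\in[n]^{k-1}}(\mathcal{T})_{i\gamma}\frac{\partial}{\partial a_{i\gamma}}\Big)^{d_i}\mathrm{tr}\big(A^{d(k-1)}\big),$$ with $A=(a_{ij})$ an $n\times n$ matrix of indeterminates, $d_i\ge0$ integers, $\frac{\partial}{\partial a_{i\gamma}}=\frac{\partial}{\partial a_{i i_2}}\cdots\frac{\partial}{\partial a_{i i_k}}$ for $\gamma=i_2\cdots i_k$. $S_\alpha$-order: for $k$-uniform hypergraphs $\mathcal{H}_1,\mathcal{H}_2$ with $n$ vertices, $\mathcal{H}_1\prec_\alpha\mathcal{H}_2$ if there is $d\in\{1,\dots,n(k-1)^{n-1}-1\}$ with $\mathrm{Tr}_t(\mathcal{A}_\alpha(\mathcal{H}_1))=\mathrm{Tr}_t(\mathcal{A}_\alpha(\mathcal{H}_2))$ for $t=0,\dots,d-1$ and $\mathrm{Tr}_d(\mathcal{A}_\alpha(\mathcal{H}_1))<\mathrm{Tr}_d(\mathcal{A}_\alpha(\mathcal{H}_2))$.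
   Formalization: It is assumed that u and v are distinct, s ≥ 1, no e_i contains v, and no moved hyperedge is already a hyperedge of H; otherwise H' equals H, is not k-uniform, or loses an edge (path u-w-v, k=2), and the claim fails. Tr_d is taken by the displayed formula. *)

theory Defs
  imports Complex_Main "HOL-Library.Poly_Mapping" "Jordan_Normal_Form.Matrix"
begin

section \<open>Uniform hypergraphs\<close>

text \<open>The vertex set is \<open>{..<n}\<close> (playing the role of \<open>[n]\<close>), and a hypergraph is given by \<open>n\<close> and
  its set of hyperedges; there are no multiple hyperedges.\<close>

definition uniform_hypergraph :: "nat \<Rightarrow> nat \<Rightarrow> nat set set \<Rightarrow> bool" where
  "uniform_hypergraph k n E \<longleftrightarrow> (\<forall>e\<in>E. e \<subseteq> {..<n} \<and> card e = k)"

definition degree :: "nat set set \<Rightarrow> nat \<Rightarrow> nat" where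
  "degree E x = card {e \<in> E. x \<in> e}"

definition cored :: "nat set set \<Rightarrow> nat \<Rightarrow> bool" where
  "cored E x \<longleftrightarrow> degree E x = 1"

text \<open>An isolated hyperedge, all of whose \<open>k\<close> vertices are cored, counts as pendant.\<close>

definition pendant :: "nat \<Rightarrow> nat set set \<Rightarrow> nat set \<Rightarrow> bool" where
  "pendant k E e \<longleftrightarrow> e \<in> E \<and> card {x \<in> e. cored E x} \<ge> k - 1"

definition move_edge :: "nat \<Rightarrow> nat \<Rightarrow> nat set \<Rightarrow> nat set" where
  "move_edge u v e = (e - {u}) \<union> {v}"

definition move_edges :: "nat set set \<Rightarrow> nat set set \<Rightarrow> nat \<Rightarrow> nat \<Rightarrow> nat set set" where
  "move_edges E P u v = (E - P) \<union> move_edge u v ` P"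

section \<open>Tensors of a hypergraph\<close>

text \<open>A tensor of order \<open>k\<close> and dimension \<open>n\<close> is a function on index lists; only its values on lists
  of length \<open>k\<close> with entries below \<open>n\<close> are ever used.\<close>

type_synonym tensor = "nat list \<Rightarrow> real"

definition adjacency_tensor :: "nat \<Rightarrow> nat set set \<Rightarrow> tensor" where
  "adjacency_tensor k E is = (if set is \<in> E then 1 / fact (k - 1) else 0)"

definition degree_tensor :: "nat set set \<Rightarrow> tensor" where
  "degree_tensor E is = (if set is = {hd is} then real (degree E (hd is)) else 0)"

definition alpha_tensor :: "real \<Rightarrow> nat \<Rightarrow> nat set set \<Rightarrow> tensor" where
  "alpha_tensor \<alpha> k E is = \<alpha> * degree_tensor E is + (1 - \<alpha>) * adjacency_tensor k E is"

section \<open>Traces of tensors\<close>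

text \<open>Polynomials in the indeterminates \<open>a\<^sub>i\<^sub>j\<close>, indexed by pairs \<open>(i, j)\<close>: a monomial is a finitely
  supported exponent function, a polynomial a finitely supported coefficient function.\<close>

type_synonym mpoly_entries = "((nat \<times> nat) \<Rightarrow>\<^sub>0 nat) \<Rightarrow>\<^sub>0 real"

definition Const :: "real \<Rightarrow> mpoly_entries" where
  "Const c = Poly_Mapping.single 0 c"

definition Var :: "nat \<times> nat \<Rightarrow> mpoly_entries" where
  "Var x = Poly_Mapping.single (Poly_Mapping.single x 1) 1"

text \<open>Formal partial derivative. The truncated subtraction of exponents is harmless, as the
  coefficient vanishes when \<open>x\<close> does not occur in \<open>m\<close>.\<close>

definition partial_deriv :: "nat \<times> nat \<Rightarrow> mpoly_entries \<Rightarrow> mpoly_entries" where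
  "partial_deriv x p = (\<Sum>m\<in>Poly_Mapping.keys p.
     Poly_Mapping.single (m - Poly_Mapping.single x 1)
       (Poly_Mapping.lookup p m * real (Poly_Mapping.lookup m x)))"

definition trace_power :: "nat \<Rightarrow> nat \<Rightarrow> mpoly_entries" where
  "trace_power n r = sum_list (diag_mat (mat n n Var ^\<^sub>m r))"

text \<open>The operator \<open>\<Sum>\<gamma>\<in>[n]\<^sup>k\<^sup>-\<^sup>1. T\<^sub>i\<^sub>\<gamma> \<partial>/\<partial>a\<^sub>i\<^sub>\<gamma>\<close>.\<close>

definition row_op :: "nat \<Rightarrow> nat \<Rightarrow> tensor \<Rightarrow> nat \<Rightarrow> mpoly_entries \<Rightarrow> mpoly_entries" where
  "row_op k n T i p = (\<Sum>\<gamma> | length \<gamma> = k - 1 \<and> set \<gamma> \<subseteq> {..<n}.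
     Const (T (i # \<gamma>)) * foldr (\<lambda>j. partial_deriv (i, j)) \<gamma> p)"

text \<open>\<open>tensor_trace k n T d\<close> is the trace of order \<open>d\<close>, that is, the sum of the \<open>d\<close>-th powers of the
  \<open>n(k - 1)\<^sup>n\<^sup>-\<^sup>1\<close> eigenvalues of \<open>T\<close>, given by the Morozov--Shakirov formula. The exponents
  \<open>d\<^sub>i\<close> are the values of \<open>\<delta>\<close>. The operators lower the degree of the homogeneous polynomial
  \<open>tr (A\<^sup>d\<^sup>(\<^sup>k\<^sup>-\<^sup>1\<^sup>))\<close> to \<open>0\<close>, so that the result is the constant read off at the monomial \<open>0\<close>.\<close>

definition tensor_trace :: "nat \<Rightarrow> nat \<Rightarrow> tensor \<Rightarrow> nat \<Rightarrow> real" where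
  "tensor_trace k n T d =
     (if d = 0 then real n * real (k - 1) ^ (n - 1)
      else real (k - 1) ^ (n - 1) *
        (\<Sum>\<delta> | (\<forall>i\<ge>n. \<delta> i = 0) \<and> (\<Sum>i<n. \<delta> i) = d.
          Poly_Mapping.lookup
            (foldr (\<lambda>i p. Const (1 / fact (\<delta> i * (k - 1))) * (row_op k n T i ^^ \<delta> i) p)
               [0..<n] (trace_power n (d * (k - 1))))
            0))"

section \<open>The \<open>S\<^sub>\<alpha>\<close>-order\<close>

definition S_alpha_less :: "real \<Rightarrow> nat \<Rightarrow> nat \<Rightarrow> nat set set \<Rightarrow> nat set set \<Rightarrow> bool" where
  "S_alpha_less \<alpha> k n E\<^sub>1 E\<^sub>2 \<longleftrightarrow>
     (\<exists>d\<in>{1..n * (k - 1) ^ (n - 1) - 1}.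
        (\<forall>t<d. tensor_trace k n (alpha_tensor \<alpha> k E\<^sub>1) t = tensor_trace k n (alpha_tensor \<alpha> k E\<^sub>2) t) \<and>
        tensor_trace k n (alpha_tensor \<alpha> k E\<^sub>1) d < tensor_trace k n (alpha_tensor \<alpha> k E\<^sub>2) d)"

end

theory Submission
  imports Defs
begin

text \<open>The two hypergraphs are separated by the second trace. In the Morozov--Shakirov formula a
  monomial of \<open>tr (A\<^sup>r)\<close> is a closed walk, so every vertex entered by an arc is also left by
  one. Hence for \<open>d \<le> 2\<close> only loops contribute, apart from the walks \<open>i \<rightarrow> j \<rightarrow> i\<close> along an edge
  when \<open>k = 2\<close>. Up to the factor \<open>(k - 1)\<^sup>n\<^sup>-\<^sup>1\<close>, the first trace is \<open>\<alpha>\<close> times the sum of the degrees,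
  and the second is \<open>\<alpha>\<^sup>2\<close> times the sum of the squared degrees plus, for \<open>k = 2\<close>, a multiple of the
  number of edges. Moving \<open>s\<close> edges from \<open>u\<close> to \<open>v\<close> preserves the degree sum and the number of edges,
  while the sum of squared degrees grows by \<open>2 s (d(v) + s - d(u)) > 0\<close>.\<close>

section \<open>Coefficients of derivatives\<close>

text \<open>A variable \<open>a_ij\<close> is read as an arc from \<open>i\<close> to
  \<open>j\<close>; a monomial, being an exponent vector, is then a finite multiset of arcs, and
  addition of exponents joins multisets.\<close>

abbreviation arc :: "'a \<Rightarrow> 'a \<Rightarrow>\<^sub>0 nat" where
  "arc x \<equiv> Poly_Mapping.single x 1"

definition arcs :: "'a list \<Rightarrow> 'a \<Rightarrow>\<^sub>0 nat" where
  "arcs xs = (\<Sum>x\<leftarrow>xs. arc x)"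

lemma arcs_simps [simp]: "arcs [] = 0" "arcs (x # xs) = arc x + arcs xs"
  by (simp_all add: arcs_def)

lemma arcs_replicate: "arcs (replicate r x) = Poly_Mapping.single x r"
  by (induction r) (simp_all add: single_add [symmetric])

lemma lookup_arcs: "Poly_Mapping.lookup (arcs xs) x = count_list xs x"
  by (induction xs) (auto simp: lookup_add lookup_single when_def)

lemma lookup_Const_mult: "Poly_Mapping.lookup (Const c * p) m = c * Poly_Mapping.lookup p m"
  unfolding Const_def mult_map_scale_conv_mult [symmetric]
  by (simp add: Poly_Mapping.map.rep_eq when_def)

text \<open>Truncated subtraction may send several monomials to \<open>m\<close>, but those without
  \<open>x\<close> carry the coefficient 0, so only \<open>m + arc x\<close> contributes.\<close>

lemma lookup_partial_deriv:
  "Poly_Mapping.lookup (partial_deriv x p) m =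
     Poly_Mapping.lookup p (m + arc x) * real (Suc (Poly_Mapping.lookup m x))"
proof -
  let ?c = "\<lambda>m'. Poly_Mapping.lookup p m' * real (Poly_Mapping.lookup m' x)"
  have eq: "(?c m' when m' - arc x = m) = (if m' = m + arc x then ?c m' else 0)" for m'
  proof (cases "Poly_Mapping.lookup m' x = 0")
    case True
    then have "m' \<noteq> m + arc x"
      by (auto simp: lookup_add)
    with True show ?thesis
      by (simp add: when_def)
  next
    case False
    then have "m' = (m' - arc x) + arc x"
      by (intro poly_mapping_eqI) (auto simp: lookup_add lookup_minus lookup_single when_def)
    then show ?thesis
      by (auto simp: when_def)
  qed
  have "Poly_Mapping.lookup (partial_deriv x p) m = (\<Sum>m'\<in>Poly_Mapping.keys p. ?c m' when m' - arc x = m)"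
    by (simp add: partial_deriv_def lookup_sum lookup_single)
  also have "\<dots> = ?c (m + arc x)"
    unfolding eq by (simp add: in_keys_iff)
  finally show ?thesis
    by (simp add: lookup_add)
qed

text \<open>The factor gained when the monomial \<open>m + arcs xs\<close> is differentiated down to
  \<open>m\<close>. As \<open>foldr\<close> applies the head last, the head sees the exponents of
  \<open>m\<close> and the tail those of \<open>m + arc x\<close>.\<close>

fun deriv_coeff :: "'a list \<Rightarrow> ('a \<Rightarrow>\<^sub>0 nat) \<Rightarrow> real" where
  "deriv_coeff [] m = 1"
| "deriv_coeff (x # xs) m = deriv_coeff xs (m + arc x) * real (Suc (Poly_Mapping.lookup m x))"

lemma lookup_foldr_partial_deriv:
  "Poly_Mapping.lookup (foldr partial_deriv xs p) m =
     Poly_Mapping.lookup p (m + arcs xs) * deriv_coeff xs m"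
  by (induction xs arbitrary: m) (simp_all add: lookup_partial_deriv add.assoc)

lemma deriv_coeff_replicate:
  "deriv_coeff (replicate r x) (Poly_Mapping.single x t) = fact (t + r) / fact t"
proof (induction r arbitrary: t)
  case (Suc r)
  have "Poly_Mapping.single x t + arc x = Poly_Mapping.single x (Suc t)"
    by (simp add: single_add [symmetric])
  with Suc [of "Suc t"] show ?case
    by (simp del: of_nat_Suc)
qed simp

lemma lookup_row_op:
  "Poly_Mapping.lookup (row_op k n T i p) m =
     (\<Sum>\<gamma> | length \<gamma> = k - 1 \<and> set \<gamma> \<subseteq> {..<n}.
        T (i # \<gamma>) * (Poly_Mapping.lookup p (m + arcs (map (Pair i) \<gamma>)) * deriv_coeff (map (Pair i) \<gamma>) m))"
proof -
  have "foldr (\<lambda>j. partial_deriv (i, j)) \<gamma> p = foldr partial_deriv (map (Pair i) \<gamma>) p" for \<gamma>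
    by (simp add: foldr_map o_def)
  then show ?thesis
    by (simp add: row_op_def lookup_sum lookup_Const_mult lookup_foldr_partial_deriv)
qed

section \<open>Coefficients of the trace of a matrix power\<close>

abbreviation var_mat :: "nat \<Rightarrow> mpoly_entries mat" where
  "var_mat n \<equiv> mat n n Var"

lemma lookup_mult_Var:
  "Poly_Mapping.lookup (p * Var x) m =
     (if Poly_Mapping.lookup m x = 0 then 0 else Poly_Mapping.lookup p (m - arc x))"
proof -
  have "(\<Sum>q. (1 when arc x = q) when m = l + q) = ((1 :: real) when m = l + arc x)" for l
    by (subst when_commute) (rule Sum_any_when_equal')
  then have "Poly_Mapping.lookup (p * Var x) m = (\<Sum>l. Poly_Mapping.lookup p l when m = l + arc x)"
    by (simp add: Var_def lookup_mult lookup_single mult_when)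
  also have "\<dots> = (if Poly_Mapping.lookup m x = 0 then 0 else Poly_Mapping.lookup p (m - arc x))"
  proof (cases "Poly_Mapping.lookup m x = 0")
    case True
    then have "m \<noteq> l + arc x" for l
      by (auto simp: lookup_add)
    with True show ?thesis
      by simp
  next
    case False
    then have "m = (m - arc x) + arc x"
      by (intro poly_mapping_eqI) (auto simp: lookup_add lookup_minus lookup_single when_def)
    then have "m = l + arc x \<longleftrightarrow> l = m - arc x" for l
      by (metis add_right_cancel)
    with False show ?thesis
      by simp
  qed
  finally show ?thesis .
qed

text \<open>Entry \<open>(a, b)\<close> of the \<open>r\<close>-th power sums the monomials of all
  walks of length \<open>r\<close> from \<open>a\<close> to \<open>b\<close>; the recursion splits
  off the last arc.\<close>

lemma var_mat_power_Suc:
  assumes "a < n" "b < n"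
  shows "(var_mat n ^\<^sub>m Suc r) $$ (a, b) = (\<Sum>c<n. (var_mat n ^\<^sub>m r) $$ (a, c) * Var (c, b))"
  using assms by (simp add: scalar_prod_def atLeast0LessThan)

lemma var_mat_power_0:
  assumes "a < n" "b < n"
  shows "(var_mat n ^\<^sub>m 0) $$ (a, b) = (if a = b then 1 else 0)"
  using assms by simp

lemma trace_power_eq: "trace_power n r = (\<Sum>a<n. (var_mat n ^\<^sub>m r) $$ (a, a))"
  by (simp add: trace_power_def diag_mat_def sum_list_sum_nth atLeast0LessThan)

declare pow_mat.simps [simp del]

lemma lookup_var_mat_power_Suc_nonzeroE:
  assumes "Poly_Mapping.lookup ((var_mat n ^\<^sub>m Suc r) $$ (a, b)) m \<noteq> 0" "a < n" "b < n"
  obtains c m' where "c < n" "m = m' + arc (c, b)" "Poly_Mapping.lookup ((var_mat n ^\<^sub>m r) $$ (a, c)) m' \<noteq> 0"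
proof -
  from assms have "(\<Sum>c<n. Poly_Mapping.lookup ((var_mat n ^\<^sub>m r) $$ (a, c) * Var (c, b)) m) \<noteq> 0"
    by (simp add: var_mat_power_Suc lookup_sum)
  then obtain c where c: "c < n" and "Poly_Mapping.lookup ((var_mat n ^\<^sub>m r) $$ (a, c) * Var (c, b)) m \<noteq> 0"
    by (meson lessThan_iff sum.neutral)
  then have "Poly_Mapping.lookup m (c, b) \<noteq> 0"
    and nz: "Poly_Mapping.lookup ((var_mat n ^\<^sub>m r) $$ (a, c)) (m - arc (c, b)) \<noteq> 0"
    by (auto simp: lookup_mult_Var split: if_splits)
  then have "m = (m - arc (c, b)) + arc (c, b)"
    by (intro poly_mapping_eqI) (auto simp: lookup_add lookup_minus lookup_single when_def)
  with c nz show ?thesis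
    by (blast intro: that)
qed

lemma var_mat_power_zero_nonzeroD:
  assumes "Poly_Mapping.lookup ((var_mat n ^\<^sub>m 0) $$ (a, b)) m \<noteq> 0" "a < n" "b < n"
  shows "a = b" "m = 0"
  using assms by (auto simp: var_mat_power_0 lookup_one split: if_splits)

text \<open>A walk leaves every vertex that it enters, except perhaps its endpoint \<open>b\<close>.
  In the induction, an arc into the endpoint \<open>c'\<close> of the shortened walk is followed by
  the last arc \<open>(c', b)\<close>.\<close>

lemma head_has_out_arc:
  assumes "Poly_Mapping.lookup ((var_mat n ^\<^sub>m r) $$ (a, b)) m \<noteq> 0" "a < n" "b < n"
    and "Poly_Mapping.lookup m (c, d) \<noteq> 0"
  shows "d = b \<or> (\<exists>d'. Poly_Mapping.lookup m (d, d') \<noteq> 0)"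
  using assms
proof (induction r arbitrary: b m)
  case 0
  then show ?case
    by (auto dest: var_mat_power_zero_nonzeroD)
next
  case (Suc r)
  from lookup_var_mat_power_Suc_nonzeroE [OF Suc.prems(1-3)] obtain c' m'
    where c': "c' < n" "m = m' + arc (c', b)" "Poly_Mapping.lookup ((var_mat n ^\<^sub>m r) $$ (a, c')) m' \<noteq> 0" .
  show ?case
  proof (cases "Poly_Mapping.lookup m' (c, d) = 0")
    case True
    with c' Suc.prems show ?thesis
      by (auto simp: lookup_add lookup_single when_def split: if_splits)
  next
    case False
    with Suc.IH [OF c'(3) Suc.prems(2) c'(1)] consider "d = c'" | d' where "Poly_Mapping.lookup m' (d, d') \<noteq> 0"
      by blast
    then show ?thesis
    proof cases
      case 1
      then show ?thesis
        by (intro disjI2 exI [of _ b]) (simp add: c'(2) lookup_add)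
    qed (auto simp: c'(2) lookup_add)
  qed
qed

text \<open>For closed walks this settles the exceptional endpoint of
  \<open>head_has_out_arc\<close>, which is then also the start.\<close>

lemma start_has_out_arc:
  assumes "Poly_Mapping.lookup ((var_mat n ^\<^sub>m Suc r) $$ (a, b)) m \<noteq> 0" "a < n" "b < n"
  shows "\<exists>d. Poly_Mapping.lookup m (a, d) \<noteq> 0"
  using assms
proof (induction r arbitrary: b m)
  case 0
  from lookup_var_mat_power_Suc_nonzeroE [OF 0] obtain c m'
    where "c < n" "m = m' + arc (c, b)" "Poly_Mapping.lookup ((var_mat n ^\<^sub>m 0) $$ (a, c)) m' \<noteq> 0" .
  with 0 var_mat_power_zero_nonzeroD [of n a c m'] show ?case
    by (intro exI [of _ b]) simp
next
  case (Suc r)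
  from lookup_var_mat_power_Suc_nonzeroE [OF Suc.prems] obtain c m'
    where *: "c < n" "m = m' + arc (c, b)" "Poly_Mapping.lookup ((var_mat n ^\<^sub>m Suc r) $$ (a, c)) m' \<noteq> 0" .
  with Suc.IH [OF *(3)] Suc.prems show ?case
    by (auto simp: lookup_add)
qed

text \<open>A walk made of loops never leaves its starting vertex, so it repeats a single
  loop.\<close>

lemma diagonal_monomial:
  assumes "Poly_Mapping.lookup ((var_mat n ^\<^sub>m r) $$ (a, b)) m \<noteq> 0" "a < n" "b < n"
    and "\<And>c d. Poly_Mapping.lookup m (c, d) \<noteq> 0 \<Longrightarrow> c = d"
  shows "a = b \<and> m = Poly_Mapping.single (a, a) r"
  using assms
proof (induction r arbitrary: b m)
  case 0
  then show ?case
    by (auto dest: var_mat_power_zero_nonzeroD)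
next
  case (Suc r)
  from lookup_var_mat_power_Suc_nonzeroE [OF Suc.prems(1-3)] obtain c m'
    where *: "c < n" "m = m' + arc (c, b)" "Poly_Mapping.lookup ((var_mat n ^\<^sub>m r) $$ (a, c)) m' \<noteq> 0" .
  have "c = b"
    by (rule Suc.prems(4)) (simp add: * lookup_add)
  moreover have "a = c \<and> m' = Poly_Mapping.single (a, a) r"
    using Suc.prems by (intro Suc.IH [OF *(3) _ *(1)]) (auto simp: *(2) lookup_add)
  ultimately show ?case
    by (simp add: *(2) single_add [symmetric])
qed

text \<open>The coefficient counts walks, and the only walk using just the loop at \<open>i\<close>
  is the one that stays at \<open>i\<close>.\<close>

lemma lookup_var_mat_power_loop:
  assumes "a < n" "b < n" "i < n"
  shows "Poly_Mapping.lookup ((var_mat n ^\<^sub>m Suc r) $$ (a, b)) (Poly_Mapping.single (i, i) (Suc r)) =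
    (if a = i \<and> b = i then 1 else 0)"
  using assms
proof (induction r arbitrary: b)
  case 0
  have "Poly_Mapping.lookup ((var_mat n ^\<^sub>m 0) $$ (a, c) * Var (c, b)) (Poly_Mapping.single (i, i) (Suc 0)) =
      (if c = i then if a = i \<and> b = i then 1 else 0 else 0)" if "c < n" for c
    using 0 that by (auto simp: var_mat_power_0 lookup_mult_Var lookup_single when_def)
  with 0 show ?case
    by (simp add: var_mat_power_Suc lookup_sum)
next
  case (Suc r)
  have eq: "Poly_Mapping.single (i, i) (Suc (Suc r)) - arc (i, i) = Poly_Mapping.single (i, i) (Suc r)"
    by (simp add: single_diff [symmetric])
  have "Poly_Mapping.lookup ((var_mat n ^\<^sub>m Suc r) $$ (a, c) * Var (c, b)) (Poly_Mapping.single (i, i) (Suc (Suc r))) =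
      (if c = i then if a = i \<and> b = i then 1 else 0 else 0)" if "c < n" for c
    using Suc.IH [of c] Suc.prems that eq by (auto simp: lookup_mult_Var lookup_single when_def)
  with Suc.prems show ?case
    by (simp add: var_mat_power_Suc [of _ _ _ "Suc r"] lookup_sum)
qed

lemma lookup_trace_power_nonzeroE:
  assumes "Poly_Mapping.lookup (trace_power n r) m \<noteq> 0"
  obtains a where "a < n" "Poly_Mapping.lookup ((var_mat n ^\<^sub>m r) $$ (a, a)) m \<noteq> 0"
proof -
  from assms have "(\<Sum>a<n. Poly_Mapping.lookup ((var_mat n ^\<^sub>m r) $$ (a, a)) m) \<noteq> 0"
    by (simp add: trace_power_eq lookup_sum)
  then show thesis
    by (meson lessThan_iff sum.neutral that)
qed

lemma trace_power_monomial_heads: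
  assumes "Poly_Mapping.lookup (trace_power n (Suc r)) m \<noteq> 0" "Poly_Mapping.lookup m (c, d) \<noteq> 0"
  shows "\<exists>d'. Poly_Mapping.lookup m (d, d') \<noteq> 0"
proof -
  from assms obtain a where a: "a < n" "Poly_Mapping.lookup ((var_mat n ^\<^sub>m Suc r) $$ (a, a)) m \<noteq> 0"
    by (blast elim: lookup_trace_power_nonzeroE)
  from head_has_out_arc [OF a(2,1,1) assms(2)] start_has_out_arc [OF a(2,1,1)] show ?thesis
    by blast
qed

lemma trace_power_diagonal_monomial:
  assumes "Poly_Mapping.lookup (trace_power n r) m \<noteq> 0"
    and "\<And>c d. Poly_Mapping.lookup m (c, d) \<noteq> 0 \<Longrightarrow> c = d"
  shows "\<exists>a. m = Poly_Mapping.single (a, a) r"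
  using assms by (metis diagonal_monomial lookup_trace_power_nonzeroE)

lemma lookup_trace_power_loop:
  assumes "i < n"
  shows "Poly_Mapping.lookup (trace_power n (Suc r)) (Poly_Mapping.single (i, i) (Suc r)) = 1"
proof -
  have "Poly_Mapping.lookup (trace_power n (Suc r)) (Poly_Mapping.single (i, i) (Suc r)) =
    (\<Sum>a<n. if a = i then 1 else 0)"
    unfolding trace_power_eq lookup_sum
    by (rule sum.cong) (use assms in \<open>auto simp: lookup_var_mat_power_loop\<close>)
  with assms show ?thesis
    by simp
qed

lemma arc_add_arc_eq_iff:
  "arc x + arc y = arc x' + arc y' \<longleftrightarrow> x = x' \<and> y = y' \<or> x = y' \<and> y = x'"
proof
  assume eq: "arc x + arc y = arc x' + arc y'"
  have "Poly_Mapping.lookup (arc x + arc y) z = Poly_Mapping.lookup (arc x' + arc y') z" for z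
    by (simp only: eq)
  from this [of x] this [of y] this [of x'] this [of y']
  show "x = x' \<and> y = y' \<or> x = y' \<and> y = x'"
    by (auto simp: lookup_add lookup_single when_def split: if_splits)
qed (metis add.commute)

text \<open>The trace of the square is the sum of all \<open>a_xy a_yx\<close>. The coefficient is 2
  because the closed walk through \<open>i\<close> and \<open>j\<close> may start at either
  vertex.\<close>

lemma lookup_trace_power_2:
  assumes "i < n" "j < n" "i \<noteq> j"
  shows "Poly_Mapping.lookup (trace_power n 2) (arc (i, c) + arc (j, d)) = (if c = j \<and> d = i then 2 else 0)"
proof -
  have 1: "(var_mat n ^\<^sub>m 1) $$ (a, b) = Var (a, b)" if "a < n" "b < n" for a b
    using that by (simp add: pow_mat.simps)
  have "trace_power n 2 = (\<Sum>a<n. \<Sum>b<n. Var (a, b) * Var (b, a))"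
    unfolding trace_power_eq
    by (rule sum.cong) (simp_all add: numeral_2_eq_2 var_mat_power_Suc [of _ _ _ "Suc 0"] 1 [simplified])
  then have "Poly_Mapping.lookup (trace_power n 2) (arc (i, c) + arc (j, d)) =
      (\<Sum>a<n. \<Sum>b<n. if arc (a, b) + arc (b, a) = arc (i, c) + arc (j, d) then 1 else 0)"
    by (simp add: lookup_sum Var_def mult_single lookup_single when_def)
  also have "\<dots> = (\<Sum>a<n. \<Sum>b<n. if (a, b) \<in> {(i, j), (j, i)} \<and> c = j \<and> d = i then 1 else 0)"
    unfolding arc_add_arc_eq_iff by (intro sum.cong refl if_cong) auto
  also have "\<dots> = (\<Sum>z\<in>{..<n}\<times>{..<n}. if z \<in> {(i, j), (j, i)} \<and> c = j \<and> d = i then 1 else 0)"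
    by (simp add: sum.cartesian_product del: insert_iff)
  also have "\<dots> = (\<Sum>z\<in>{(i, j), (j, i)}. if c = j \<and> d = i then 1 else 0)"
    by (rule sum.mono_neutral_cong_right) (use assms in auto)
  also have "\<dots> = (if c = j \<and> d = i then 2 else 0)"
    using assms by auto
  finally show ?thesis .
qed

section \<open>Traces of order one and two\<close>

lemma row_op_Const_mult: "row_op k n T i (Const c * p) = Const c * row_op k n T i p"
  by (rule poly_mapping_eqI)
     (simp add: lookup_row_op lookup_Const_mult sum_distrib_left mult.left_commute mult.assoc)

lemma finite_index_lists: "finite {\<gamma>. length \<gamma> = r \<and> set \<gamma> \<subseteq> {..<n::nat}}"
  using finite_lists_length_eq [of "{..<n}" r] by (simp add: conj_commute)

lemma lookup_arcs_row_pos: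
  "0 < Poly_Mapping.lookup (arcs (map (Pair i) \<gamma>)) (c, d) \<longleftrightarrow> c = i \<and> d \<in> set \<gamma>"
  unfolding neq0_conv [symmetric] lookup_arcs count_list_0_iff by auto

text \<open>If all arcs of a closed walk leave \<open>i\<close>, then every head, having an outgoing
  arc itself, equals \<open>i\<close>.\<close>

lemma trace_power_row_monomial:
  assumes "Poly_Mapping.lookup (trace_power n (Suc r)) m \<noteq> 0"
    and "\<And>c d. Poly_Mapping.lookup m (c, d) \<noteq> 0 \<Longrightarrow> c = i"
    and "\<And>d. d \<in> set \<gamma> \<Longrightarrow> Poly_Mapping.lookup m (i, d) \<noteq> 0"
  shows "\<gamma> = replicate (length \<gamma>) i"
  using trace_power_monomial_heads [OF assms(1)] assms(2,3)
  by (metis replicate_eqI)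

text \<open>All differentiated arcs leave \<open>i\<close>, so only the constant list survives;
  differentiating the \<open>(k - 1)\<close>-st power of \<open>a_ii\<close> completely yields the
  factorial.\<close>

lemma lookup_row_op_trace_power:
  assumes "k \<ge> 2" "i < n"
  shows "Poly_Mapping.lookup (row_op k n T i (trace_power n (k - 1))) 0 =
    T (replicate k i) * fact (k - 1)"
proof -
  from assms obtain q where k: "k = Suc (Suc q)"
    by (metis add_2_eq_Suc le_Suc_ex)
  let ?\<gamma> = "replicate (Suc q) i" and ?f = "\<lambda>\<gamma>. T (i # \<gamma>) *
    (Poly_Mapping.lookup (trace_power n (Suc q)) (arcs (map (Pair i) \<gamma>)) * deriv_coeff (map (Pair i) \<gamma>) 0)"
  have zero: "?f \<gamma> = 0" if "length \<gamma> = Suc q" "\<gamma> \<noteq> ?\<gamma>" for \<gamma>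
  proof (rule ccontr)
    assume "?f \<gamma> \<noteq> 0"
    then have "\<gamma> = replicate (length \<gamma>) i"
      by (intro trace_power_row_monomial [of n q "arcs (map (Pair i) \<gamma>)"])
        (auto simp: lookup_arcs_row_pos)
    with that show False
      by simp
  qed
  have "Poly_Mapping.lookup (row_op k n T i (trace_power n (k - 1))) 0 =
      (\<Sum>\<gamma> | length \<gamma> = Suc q \<and> set \<gamma> \<subseteq> {..<n}. ?f \<gamma>)"
    by (simp add: lookup_row_op k del: replicate.simps)
  also have "\<dots> = (\<Sum>\<gamma>\<in>{?\<gamma>}. ?f \<gamma>)"
    by (rule sum.mono_neutral_right)
      (use zero assms in \<open>auto simp: finite_index_lists simp del: replicate.simps\<close>)
  also have "\<dots> = T (replicate k i) * fact (k - 1)"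
    using lookup_trace_power_loop [OF assms(2), of q] deriv_coeff_replicate [of "Suc q" "(i, i)" 0]
    by (simp add: k arcs_replicate map_replicate del: replicate_Suc deriv_coeff.simps fact_Suc)
       (simp add: k)
  finally show ?thesis .
qed

lemma lookup_row_op_row_op_trace_power:
  assumes "k \<ge> 2" "i < n"
  shows "Poly_Mapping.lookup (row_op k n T i (row_op k n T i (trace_power n (2 * (k - 1))))) 0 =
    T (replicate k i) ^ 2 * fact (2 * (k - 1))"
proof -
  from assms obtain q where k: "k = Suc (Suc q)"
    by (metis add_2_eq_Suc le_Suc_ex)
  let ?\<gamma> = "replicate (Suc q) i" and ?\<Gamma> = "{\<gamma>. length \<gamma> = Suc q \<and> set \<gamma> \<subseteq> {..<n}}"
  let ?p = "trace_power n (2 * Suc q)"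
  \<comment> \<open>Here \<gamma> belongs to the outer operator and \<gamma>' to the inner one,
    which acts first.\<close>
  let ?f = "\<lambda>\<gamma> \<gamma>'. T (i # \<gamma>') *
    (Poly_Mapping.lookup ?p (arcs (map (Pair i) \<gamma>) + arcs (map (Pair i) \<gamma>')) *
     deriv_coeff (map (Pair i) \<gamma>') (arcs (map (Pair i) \<gamma>)))"
  let ?F = "\<lambda>\<gamma>. T (i # \<gamma>) * ((\<Sum>\<gamma>'\<in>?\<Gamma>. ?f \<gamma> \<gamma>') * deriv_coeff (map (Pair i) \<gamma>) 0)"
  have zero: "?f \<gamma> \<gamma>' = 0"
    if "length \<gamma> = Suc q" "length \<gamma>' = Suc q" "\<gamma> \<noteq> ?\<gamma> \<or> \<gamma>' \<noteq> ?\<gamma>" for \<gamma> \<gamma>'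
  proof (rule ccontr)
    assume "?f \<gamma> \<gamma>' \<noteq> 0"
    then have nz: "Poly_Mapping.lookup (trace_power n (Suc (Suc (2 * q)))) (arcs (map (Pair i) \<gamma>) + arcs (map (Pair i) \<gamma>')) \<noteq> 0"
      by simp
    have "\<gamma> = replicate (length \<gamma>) i" "\<gamma>' = replicate (length \<gamma>') i"
      by (rule trace_power_row_monomial [OF nz];
          auto simp: lookup_add lookup_arcs_row_pos)+
    with that show False
      by simp
  qed
  have inner_zero: "(\<Sum>\<gamma>'\<in>?\<Gamma>. ?f \<gamma> \<gamma>') = 0" if "length \<gamma> = Suc q" "\<gamma> \<noteq> ?\<gamma>" for \<gamma>
    by (rule sum.neutral) (use zero that in blast)
  have "Poly_Mapping.lookup (row_op k n T i (row_op k n T i (trace_power n (2 * (k - 1))))) 0 =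
      (\<Sum>\<gamma>\<in>?\<Gamma>. ?F \<gamma>)"
    by (simp add: lookup_row_op k del: replicate.simps)
  also have "\<dots> = (\<Sum>\<gamma>\<in>{?\<gamma>}. ?F \<gamma>)"
    by (rule sum.mono_neutral_right)
      (use assms inner_zero in \<open>auto simp: finite_index_lists simp del: replicate.simps\<close>)
  also have "(\<Sum>\<gamma>'\<in>?\<Gamma>. ?f ?\<gamma> \<gamma>') = (\<Sum>\<gamma>'\<in>{?\<gamma>}. ?f ?\<gamma> \<gamma>')"
  proof (rule sum.mono_neutral_right)
    show "\<forall>\<gamma>'\<in>?\<Gamma> - {?\<gamma>}. ?f ?\<gamma> \<gamma>' = 0"
      by (intro ballI zero) auto
  qed (use assms in \<open>auto simp: finite_index_lists\<close>)
  then have "(\<Sum>\<gamma>\<in>{?\<gamma>}. ?F \<gamma>) = T (i # ?\<gamma>) * (?f ?\<gamma> ?\<gamma> * deriv_coeff (map (Pair i) ?\<gamma>) 0)"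
    by (simp del: replicate.simps)
  \<comment> \<open>The inner operator lowers the exponent of \<open>a_ii\<close> from
    \<open>2 * Suc q\<close> to \<open>Suc q\<close>; the outer one then lowers it to 0 and
    contributes the cancelling \<open>fact (Suc q)\<close>.\<close>
  also have "?f ?\<gamma> ?\<gamma> = T (i # ?\<gamma>) * (fact (2 * Suc q) / fact (Suc q))"
  proof -
    have "Poly_Mapping.single (i, i) (Suc q) + Poly_Mapping.single (i, i) (Suc q) =
        Poly_Mapping.single (i, i) (Suc (Suc (2 * q)))"
      by (simp add: single_add [symmetric] mult_2)
    with lookup_trace_power_loop [OF assms(2), of "Suc (2 * q)"]
    show ?thesis
      unfolding map_replicate arcs_replicate deriv_coeff_replicate by (simp add: mult_2 del: fact_Suc)
  qed
  also have "deriv_coeff (map (Pair i) ?\<gamma>) 0 = fact (Suc q)"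
    using deriv_coeff_replicate [of "Suc q" "(i, i)" 0] by (simp add: map_replicate del: replicate.simps fact_Suc)
  finally show ?thesis
    by (simp add: k power2_eq_square del: fact_Suc)
qed

text \<open>For \<open>k = 2\<close> each operator takes one derivative, and the only monomial of
  the trace with one arc out of \<open>i\<close> and one out of \<open>j\<close> is
  \<open>a_ij a_ji\<close>.\<close>

lemma lookup_row_op_pair_trace_power_2:
  assumes "i < n" "j < n" "i \<noteq> j"
  shows "Poly_Mapping.lookup (row_op 2 n T i (row_op 2 n T j (trace_power n 2))) 0 = 2 * T [i, j] * T [j, i]"
proof -
  have set_eq: "{\<gamma>. length \<gamma> = Suc 0 \<and> set \<gamma> \<subseteq> {..<n}} = (\<lambda>c. [c]) ` {..<n}"
    by (auto simp: length_Suc_conv)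
  have reindex: "(\<Sum>\<gamma> | length \<gamma> = Suc 0 \<and> set \<gamma> \<subseteq> {..<n}. f \<gamma>) = (\<Sum>c<n. f [c])" for f :: "nat list \<Rightarrow> real"
    unfolding set_eq by (subst sum.reindex) (auto simp: inj_on_def)
  have "Poly_Mapping.lookup (row_op 2 n T i (row_op 2 n T j (trace_power n 2))) 0 =
      (\<Sum>c<n. T [i, c] * (\<Sum>d<n. T [j, d] * Poly_Mapping.lookup (trace_power n 2) (arc (i, c) + arc (j, d))))"
    using assms by (simp add: lookup_row_op reindex lookup_single_not_eq)
  also have "\<dots> = (\<Sum>c<n. \<Sum>d<n. if d = i then if c = j then 2 * T [i, j] * T [j, i] else 0 else 0)"
    unfolding sum_distrib_left lookup_trace_power_2 [OF assms] by (intro sum.cong refl) auto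
  also have "\<dots> = 2 * T [i, j] * T [j, i]"
    using assms by simp
  finally show ?thesis .
qed

text \<open>Every arc leaves \<open>i\<close> or \<open>j\<close>, so all heads lie in
  \<open>{i, j}\<close>. As \<open>k\<close> exceeds 2, the support condition on \<open>T\<close>
  makes both index lists constant. All arcs are then loops, at \<open>i\<close> and at
  \<open>j\<close>, which no closed walk can combine.\<close>

lemma lookup_row_op_pair_trace_power_zero:
  assumes "k \<ge> 3" "i \<noteq> j"
    and T: "\<And>is. length is = k \<Longrightarrow> T is \<noteq> 0 \<Longrightarrow> card (set is) \<in> {1, k}"
  shows "Poly_Mapping.lookup (row_op k n T i (row_op k n T j (trace_power n (2 * (k - 1))))) 0 = 0"
proof -
  from assms obtain q where k: "k = Suc (Suc (Suc q))"
    by (metis add_2_eq_Suc add_Suc le_Suc_ex numeral_3_eq_3 numeral_2_eq_2)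
  let ?p = "trace_power n (2 * (k - 1))"
  have zero: "T (i # \<gamma>) * (T (j # \<gamma>') *
      Poly_Mapping.lookup ?p (arcs (map (Pair i) \<gamma>) + arcs (map (Pair j) \<gamma>'))) = 0"
    if len: "length \<gamma> = k - 1" "length \<gamma>' = k - 1" for \<gamma> \<gamma>'
  proof (rule ccontr)
    let ?m = "arcs (map (Pair i) \<gamma>) + arcs (map (Pair j) \<gamma>')"
    have supp: "Poly_Mapping.lookup ?m (c, d) \<noteq> 0 \<longleftrightarrow> c = i \<and> d \<in> set \<gamma> \<or> c = j \<and> d \<in> set \<gamma>'" for c d
      using lookup_arcs_row_pos [of i \<gamma> c d] lookup_arcs_row_pos [of j \<gamma>' c d]
      by (auto simp: lookup_add)
    assume "\<not> ?thesis"
    then have Tnz: "T (i # \<gamma>) \<noteq> 0" "T (j # \<gamma>') \<noteq> 0" and nz: "Poly_Mapping.lookup ?p ?m \<noteq> 0"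
      by auto
    have "2 * (k - 1) = Suc (2 * Suc q + 1)"
      by (simp add: k)
    from nz have nz': "Poly_Mapping.lookup (trace_power n (Suc (2 * Suc q + 1))) ?m \<noteq> 0"
      unfolding \<open>2 * (k - 1) = Suc (2 * Suc q + 1)\<close> .
    have sub: "set (i # \<gamma>) \<subseteq> {i, j}" "set (j # \<gamma>') \<subseteq> {i, j}"
      using trace_power_monomial_heads [OF nz'] unfolding supp by auto
    then have "card (set (i # \<gamma>)) \<le> 2" "card (set (j # \<gamma>')) \<le> 2"
      using card_mono [OF _ sub(1)] card_mono [OF _ sub(2)] \<open>i \<noteq> j\<close> by simp_all
    with T [OF _ Tnz(1)] T [OF _ Tnz(2)] len k
    have "card (set (i # \<gamma>)) = 1" "card (set (j # \<gamma>')) = 1"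
      by auto
    then have "set \<gamma> \<subseteq> {i}" "set \<gamma>' \<subseteq> {j}"
      by (auto simp: card_1_singleton_iff)
    moreover from this have "c = d" if "Poly_Mapping.lookup ?m (c, d) \<noteq> 0" for c d
      using that unfolding supp by blast
    from trace_power_diagonal_monomial [OF nz this] obtain a where "?m = Poly_Mapping.single (a, a) (2 * (k - 1))" ..
    then have "c = a" if "c = i \<and> d \<in> set \<gamma> \<or> c = j \<and> d \<in> set \<gamma>'" for c d
      using that supp [of c d] by (auto simp: lookup_single when_def split: if_splits)
    \<comment> \<open>Both loops really occur, so the single vertex \<open>a\<close> would equal
      both \<open>i\<close> and \<open>j\<close>.\<close>
    moreover have "\<gamma> \<noteq> []" "\<gamma>' \<noteq> []"
      using len k by auto
    ultimately show False
      using \<open>i \<noteq> j\<close> by (metis last_in_set)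
  qed
  have "T (i # \<gamma>) * (T (j # \<gamma>') *
      (Poly_Mapping.lookup ?p (arcs (map (Pair i) \<gamma>) + arcs (map (Pair j) \<gamma>')) * c) * c') = 0"
    if "length \<gamma> = k - 1" "length \<gamma>' = k - 1" for \<gamma> \<gamma>' c c'
    using zero [OF that] by auto
  then show ?thesis
    by (auto simp: lookup_row_op sum_distrib_left sum_distrib_right intro!: sum.neutral)
qed

section \<open>Exponent vectors of weight one and two\<close>

lemma foldr_row_ops:
  fixes \<delta> :: "nat \<Rightarrow> nat" and k n :: nat and T :: tensor
  defines "F \<equiv> \<lambda>i p. Const (1 / fact (\<delta> i * (k - 1))) * (row_op k n T i ^^ \<delta> i) p"
  shows "foldr F xs p = foldr F (filter (\<lambda>i. \<delta> i \<noteq> 0) xs) p"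
proof (induction xs)
  case (Cons x xs)
  have "F x q = q" if "\<delta> x = 0" for q
    using that by (intro poly_mapping_eqI) (simp add: F_def lookup_Const_mult)
  with Cons show ?case
    by simp
qed simp

lemma filter_upt_singleton:
  assumes "i < n" shows "filter (\<lambda>x. x = i) [0..<n] = [i]"
  using assms by (intro sorted_distinct_set_unique) (auto intro!: sorted_wrt_filter)

lemma filter_upt_pair:
  assumes "i < j" "j < n" shows "filter (\<lambda>x. x = i \<or> x = j) [0..<n] = [i, j]"
  using assms by (intro sorted_distinct_set_unique) (auto intro!: sorted_wrt_filter)

lemma exponents_1:
  fixes n :: nat
  shows
  "{\<delta>. (\<forall>i\<ge>n. \<delta> i = 0) \<and> (\<Sum>i<n. \<delta> i) = (1 :: nat)} = (\<lambda>i. (\<lambda>_. 0)(i := 1)) ` {..<n}"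
proof (intro equalityI subsetI)
  fix \<delta> :: "nat \<Rightarrow> nat"
  assume "\<delta> \<in> {\<delta>. (\<forall>i\<ge>n. \<delta> i = 0) \<and> (\<Sum>i<n. \<delta> i) = 1}"
  then obtain i where "i < n" "\<delta> i = 1" "\<forall>b<n. i \<noteq> b \<longrightarrow> \<delta> b = 0" "\<forall>i\<ge>n. \<delta> i = 0"
    by (auto simp: sum_eq_Suc0_iff)
  then have "\<delta> = (\<lambda>_. 0)(i := 1)"
    by (auto simp: fun_eq_iff) (metis not_le)
  with \<open>i < n\<close> show "\<delta> \<in> (\<lambda>i. (\<lambda>_. 0)(i := 1)) ` {..<n}"
    by blast
qed (auto simp: fun_upd_def)

text \<open>Weight 2 means one entry 2 or two entries 1; requiring \<open>i < j\<close> lists each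
  pair of positions once.\<close>

lemma exponents_2:
  fixes n :: nat
  shows
  "{\<delta>. (\<forall>i\<ge>n. \<delta> i = 0) \<and> (\<Sum>i<n. \<delta> i) = (2 :: nat)} =
     (\<lambda>i. (\<lambda>_. 0)(i := 2)) ` {..<n} \<union> (\<lambda>(i, j). (\<lambda>_. 0)(i := 1, j := 1)) ` {(i, j). i < j \<and> j < n}"
    (is "?L = ?R1 \<union> ?R2")
proof (intro equalityI subsetI)
  fix \<delta> :: "nat \<Rightarrow> nat"
  assume "\<delta> \<in> ?L"
  then have 0: "\<And>i. i \<ge> n \<Longrightarrow> \<delta> i = 0" and 2: "(\<Sum>i<n. \<delta> i) = 2"
    by auto
  from 2 obtain i where i: "i < n" "\<delta> i \<noteq> 0"
    by (metis lessThan_iff sum.neutral zero_neq_numeral)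
  then have sum: "\<delta> i + (\<Sum>b\<in>{..<n} - {i}. \<delta> b) = 2"
    using 2 by (simp add: sum.remove [of "{..<n}" i])
  show "\<delta> \<in> ?R1 \<union> ?R2"
  proof (cases "\<delta> i = 2")
    case True
    with sum have "\<forall>b\<in>{..<n} - {i}. \<delta> b = 0"
      by simp
    with True 0 have "\<delta> = (\<lambda>_. 0)(i := 2)"
      by (auto simp: fun_eq_iff) (metis Diff_iff lessThan_iff not_le singletonD)
    with i show ?thesis
      by blast
  next
    case False
    with sum i have "\<delta> i = 1" "(\<Sum>b\<in>{..<n} - {i}. \<delta> b) = 1"
      by linarith+
    then obtain j where j: "j < n" "i \<noteq> j" "\<delta> j = 1" "\<forall>b\<in>{..<n} - {i}. j \<noteq> b \<longrightarrow> \<delta> b = 0"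
      by (auto simp: sum_eq_Suc0_iff)
    have "\<delta> b = ((\<lambda>_. 0)(i := 1, j := 1)) b" for b
      using j \<open>\<delta> i = 1\<close> 0 [of b] by (cases "b < n") auto
    then have \<delta>: "\<delta> = (\<lambda>_. 0)(i := 1, j := 1)" "\<delta> = (\<lambda>_. 0)(j := 1, i := 1)"
      using j by (auto simp: fun_eq_iff)
    show ?thesis
    \<comment> \<open>The position \<open>i\<close> was chosen as any nonzero entry, so the pair
      still has to be ordered; hence both update orders of \<delta> above.\<close>
    proof (cases "i < j")
      case True
      with \<delta> j show ?thesis
        by (intro UnI2 image_eqI [of _ _ "(i, j)"]) auto
    next
      case False
      with \<delta> i j show ?thesis
        by (intro UnI2 image_eqI [of _ _ "(j, i)"]) auto
    qed
  qed
next
  fix \<delta> :: "nat \<Rightarrow> nat"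
  assume "\<delta> \<in> ?R1 \<union> ?R2"
  then consider i where "i < n" "\<delta> = (\<lambda>_. 0)(i := 2)"
    | i j where "i < j" "j < n" "\<delta> = (\<lambda>_. 0)(i := 1, j := 1)"
    by auto
  then show "\<delta> \<in> ?L"
  proof cases
    case 2
    have "(\<Sum>x<n. \<delta> x) = (\<Sum>x\<in>{i, j}. \<delta> x)"
      by (rule sum.mono_neutral_right) (use 2 in auto)
    with 2 show ?thesis
      by auto
  qed (auto simp: fun_upd_def)
qed

section \<open>Evaluation of the first two traces\<close>

lemma tensor_trace_1:
  assumes "k \<ge> 2"
  shows "tensor_trace k n T 1 = real (k - 1) ^ (n - 1) * (\<Sum>i<n. T (replicate k i))"
proof -
  let ?F = "\<lambda>\<delta> i p. Const (1 / fact (\<delta> i * (k - 1))) * (row_op k n T i ^^ \<delta> i) p"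
  \<comment> \<open>The factor \<open>1 * (k - 1)\<close> stays unsimplified so that
    \<open>G\<close> literally matches the unfolded trace at order 1.\<close>
  define G where "G \<delta> = Poly_Mapping.lookup (foldr (?F \<delta>) [0..<n] (trace_power n (1 * (k - 1)))) 0" for \<delta>
  have one: "G ((\<lambda>_. 0)(i := 1)) = T (replicate k i)" if "i < n" for i
  proof -
    have "filter (\<lambda>x. ((\<lambda>_. 0)(i := 1 :: nat)) x \<noteq> 0) [0..<n] = [i]"
      using that filter_upt_singleton [of i n] by (simp add: fun_upd_def cong: if_cong)
    with lookup_row_op_trace_power [OF assms that, of T] show ?thesis
      unfolding G_def by (subst foldr_row_ops) (simp add: lookup_Const_mult)
  qed
  have "sum G ((\<lambda>i. (\<lambda>_. 0)(i := 1)) ` {..<n}) = (\<Sum>i<n. T (replicate k i))"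
    by (subst sum.reindex) (auto simp: one inj_on_def fun_eq_iff simp del: One_nat_def split: if_splits)
  then show ?thesis
    by (simp only: tensor_trace_def exponents_1 one_neq_zero if_False G_def [symmetric])
qed

text \<open>For the exponent vector with a single entry 2 at \<open>i\<close>, the factorial from
  differentiation cancels the normalising one. Vectors with two entries 1 give the mixed terms,
  which vanish for \<open>k\<close> at least 3.\<close>

lemma tensor_trace_2:
  assumes "k \<ge> 2"
    and T: "\<And>is. length is = k \<Longrightarrow> T is \<noteq> 0 \<Longrightarrow> card (set is) \<in> {1, k}"
  shows "tensor_trace k n T 2 = real (k - 1) ^ (n - 1) *
    ((\<Sum>i<n. T (replicate k i) ^ 2) +
     (if k = 2 then \<Sum>(i, j) | i < j \<and> j < n. 2 * T [i, j] * T [j, i] else 0))"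
proof -
  let ?F = "\<lambda>\<delta> i p. Const (1 / fact (\<delta> i * (k - 1))) * (row_op k n T i ^^ \<delta> i) p"
  define G where "G \<delta> = Poly_Mapping.lookup (foldr (?F \<delta>) [0..<n] (trace_power n (2 * (k - 1)))) 0" for \<delta>
  let ?Q = "{(i, j). i < j \<and> j < n}"
  have fin: "finite ?Q"
    by (rule finite_subset [of _ "{..<n} \<times> {..<n}"]) auto
  have funpow_2: "(f ^^ 2) p = f (f p)" for f :: "mpoly_entries \<Rightarrow> mpoly_entries" and p
    by (simp add: numeral_2_eq_2)
  have one: "G ((\<lambda>_. 0)(i := 2)) = T (replicate k i) ^ 2" if "i < n" for i
  proof -
    have "filter (\<lambda>x. ((\<lambda>_. 0)(i := 2 :: nat)) x \<noteq> 0) [0..<n] = [i]"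
      using that filter_upt_singleton [of i n] by (simp add: fun_upd_def cong: if_cong)
    with lookup_row_op_row_op_trace_power [OF assms(1) that, of T] show ?thesis
      unfolding G_def by (subst foldr_row_ops) (simp add: lookup_Const_mult funpow_2)
  qed
  have two: "G ((\<lambda>_. 0)(i := 1, j := 1)) = (if k = 2 then 2 * T [i, j] * T [j, i] else 0)"
    if "i < j" "j < n" for i j
  proof -
    have "(\<lambda>x. ((\<lambda>_. 0)(i := 1, j := 1 :: nat)) x \<noteq> 0) = (\<lambda>x. x = i \<or> x = j)"
      by auto
    then have "filter (\<lambda>x. ((\<lambda>_. 0)(i := 1, j := 1 :: nat)) x \<noteq> 0) [0..<n] = [i, j]"
      using filter_upt_pair [OF that] by (simp only:)
    then have "G ((\<lambda>_. 0)(i := 1, j := 1)) = 1 / fact (k - 1) * (1 / fact (k - 1) *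
        Poly_Mapping.lookup (row_op k n T i (row_op k n T j (trace_power n (2 * (k - 1))))) 0)"
      using that unfolding G_def by (subst foldr_row_ops) (simp add: lookup_Const_mult row_op_Const_mult)
    \<comment> \<open>For \<open>k = 2\<close> both normalising factors are
      \<open>1 / fact 1 = 1\<close>.\<close>
    also have "\<dots> = (if k = 2 then 2 * T [i, j] * T [j, i] else 0)"
      using that assms lookup_row_op_pair_trace_power_2 [of i n j T]
        lookup_row_op_pair_trace_power_zero [of k i j T n]
      by (cases "k = 2") auto
    finally show ?thesis .
  qed
  have "sum G ((\<lambda>i. (\<lambda>_. 0)(i := 2)) ` {..<n}) = (\<Sum>i<n. T (replicate k i) ^ 2)"
    by (subst sum.reindex) (auto simp: one inj_on_def fun_eq_iff split: if_splits)
  moreover have "sum G ((\<lambda>(i, j). (\<lambda>_. 0)(i := 1, j := 1)) ` ?Q) =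
      (\<Sum>(i, j)\<in>?Q. if k = 2 then 2 * T [i, j] * T [j, i] else 0)"
  proof (subst sum.reindex)
    show "inj_on (\<lambda>(i, j). (\<lambda>_. 0 :: nat)(i := 1, j := 1)) ?Q"
    proof (rule inj_onI, clarify)
      fix i j i' j' :: nat
      assume *: "i < j" "i' < j'" "(\<lambda>_. 0 :: nat)(i := 1, j := 1) = (\<lambda>_. 0)(i' := 1, j' := 1)"
      \<comment> \<open>The support recovers the unordered pair, and the order of its entries the
        ordered one.\<close>
      have supp: "{x. ((\<lambda>_. 0 :: nat)(a := 1, b := 1)) x \<noteq> 0} = {a, b}" for a b :: nat
        by auto
      from *(3) have "{i, j} = {i', j'}"
        by (metis supp)
      with * show "i = i' \<and> j = j'"
        by (auto simp: doubleton_eq_iff)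
    qed
  qed (auto intro!: sum.cong simp: two simp del: One_nat_def)
  moreover have "(\<lambda>i. (\<lambda>_. 0 :: nat)(i := 2)) ` {..<n} \<inter> (\<lambda>(i, j). (\<lambda>_. 0)(i := 1, j := 1)) ` ?Q = {}"
  proof -
    have distinct: "(\<lambda>_. 0)(i := 2) \<noteq> (\<lambda>_. 0 :: nat)(a := 1, b := 1)" for i a b :: nat
    proof
      assume "(\<lambda>_. 0)(i := 2) = (\<lambda>_. 0 :: nat)(a := 1, b := 1)"
      from fun_cong [OF this, of i] show False
        by (auto split: if_splits)
    qed
    show ?thesis
      by (auto simp: distinct simp del: One_nat_def)
  qed
  moreover have "tensor_trace k n T 2 = real (k - 1) ^ (n - 1) *
      sum G ((\<lambda>i. (\<lambda>_. 0)(i := 2)) ` {..<n} \<union> (\<lambda>(i, j). (\<lambda>_. 0)(i := 1, j := 1)) ` ?Q)"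
    by (simp only: tensor_trace_def exponents_2 zero_neq_numeral [symmetric] if_False G_def [symmetric])
  moreover note fin
  ultimately show ?thesis
    by (cases "k = 2") (simp_all add: sum.union_disjoint del: One_nat_def)
qed

section \<open>Degrees under moving edges\<close>

lemma uniform_hypergraph_finite: "uniform_hypergraph k n E \<Longrightarrow> finite E"
  by (rule finite_subset [of _ "Pow {..<n}"]) (auto simp: uniform_hypergraph_def)

lemma inj_on_move_edge:
  assumes "\<And>e. e \<in> P \<Longrightarrow> u \<in> e \<and> v \<notin> e"
  shows "inj_on (move_edge u v) P"
proof (rule inj_on_inverseI)
  fix e assume "e \<in> P"
  with assms show "insert u (move_edge u v e - {v}) = e"
    by (fastforce simp: move_edge_def)
qed

text \<open>Hyperedges form a set, so a moved edge coinciding with an old one would be lost;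
  \<open>new\<close> excludes this, and \<open>ends\<close> makes moving injective on
  \<open>P\<close>.\<close>

context
  fixes E P :: "nat set set" and u v :: nat
  assumes fin: "finite E" and sub: "P \<subseteq> E"
    and ends: "\<And>e. e \<in> P \<Longrightarrow> u \<in> e \<and> v \<notin> e"
    and new: "\<And>e. e \<in> P \<Longrightarrow> move_edge u v e \<notin> E"
begin

lemma card_move_edges: "card (move_edges E P u v) = card E"
proof -
  have "card (move_edges E P u v) = card (E - P) + card (move_edge u v ` P)"
    unfolding move_edges_def using fin sub new
    by (intro card_Un_disjoint) (auto intro: finite_subset)
  also have "\<dots> = card E"
    using fin sub by (simp add: card_image inj_on_move_edge [OF ends] card_Diff_subset finite_subset card_mono)
  finally show ?thesis .
qed

text \<open>Both degrees share the contribution of \<open>E - P\<close>. The additive form avoids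
  truncated subtraction.\<close>

lemma degree_move_edges:
  "degree (move_edges E P u v) w + card {e \<in> P. w \<in> e} = degree E w + card {e \<in> P. w \<in> move_edge u v e}"
proof -
  have finP: "finite P"
    using fin sub by (rule rev_finite_subset)
  have inj: "inj_on (move_edge u v) {e \<in> P. w \<in> move_edge u v e}"
    by (rule inj_on_subset [OF inj_on_move_edge [OF ends]]) auto
  have "{e \<in> move_edges E P u v. w \<in> e} =
      {e \<in> E - P. w \<in> e} \<union> move_edge u v ` {e \<in> P. w \<in> move_edge u v e}"
    by (auto simp: move_edges_def)
  moreover have "card \<dots> = card {e \<in> E - P. w \<in> e} + card {e \<in> P. w \<in> move_edge u v e}"
    using fin finP new by (subst card_Un_disjoint) (auto simp: card_image [OF inj])
  moreover have "{e \<in> E. w \<in> e} = {e \<in> E - P. w \<in> e} \<union> {e \<in> P. w \<in> e}"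
    using sub by auto
  moreover have "card \<dots> = card {e \<in> E - P. w \<in> e} + card {e \<in> P. w \<in> e}"
    using fin finP by (intro card_Un_disjoint) auto
  ultimately show ?thesis
    by (simp add: degree_def)
qed

lemma degree_move_edges_other:
  "w \<noteq> u \<Longrightarrow> w \<noteq> v \<Longrightarrow> degree (move_edges E P u v) w = degree E w"
  using degree_move_edges [of w] by (simp add: move_edge_def)

lemma degree_move_edges_source:
  assumes "u \<noteq> v" shows "degree (move_edges E P u v) u + card P = degree E u"
proof -
  have "{e \<in> P. u \<in> e} = P" "{e \<in> P. u \<in> move_edge u v e} = {}"
    using ends assms by (auto simp: move_edge_def)
  with degree_move_edges [of u] show ?thesis
    by simp
qed

lemma degree_move_edges_target: "degree (move_edges E P u v) v = degree E v + card P"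
proof -
  have "{e \<in> P. v \<in> e} = {}" "{e \<in> P. v \<in> move_edge u v e} = P"
    using ends by (auto simp: move_edge_def)
  with degree_move_edges [of v] show ?thesis
    by simp
qed

text \<open>Only the terms at \<open>u\<close> and \<open>v\<close> change. The function
  \<open>f\<close> is general so as to serve both the degree sum and the sum of squares.\<close>

lemma sum_degree_move_edges:
  fixes f :: "nat \<Rightarrow> 'a::ab_group_add"
  assumes "u < n" "v < n" "u \<noteq> v"
  shows "(\<Sum>i<n. f (degree (move_edges E P u v) i)) = (\<Sum>i<n. f (degree E i)) +
    (f (degree E u - card P) - f (degree E u)) + (f (degree E v + card P) - f (degree E v))"
proof -
  have split: "(\<Sum>i<n. g i) = g u + (g v + (\<Sum>i\<in>{..<n} - {u} - {v}. g i))" for g :: "nat \<Rightarrow> 'a"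
    using assms by (simp add: sum.remove [of "{..<n}" u] sum.remove [of "{..<n} - {u}" v])
  have "degree (move_edges E P u v) u = degree E u - card P"
    using degree_move_edges_source [OF assms(3)] by simp
  then show ?thesis
    unfolding split by (simp add: degree_move_edges_target degree_move_edges_other)
qed

end

lemma uniform_move_edges:
  assumes "uniform_hypergraph k n E" "P \<subseteq> E" "v < n"
    and "\<And>e. e \<in> P \<Longrightarrow> u \<in> e \<and> v \<notin> e"
  shows "uniform_hypergraph k n (move_edges E P u v)"
proof -
  have "card (move_edge u v e) = k \<and> move_edge u v e \<subseteq> {..<n}" if "e \<in> P" for e
  proof -
    have e: "e \<subseteq> {..<n}" "card e = k" "u \<in> e" "v \<notin> e"
      using assms that by (auto simp: uniform_hypergraph_def)
    then have "finite e"
      by (auto intro: finite_subset)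
    with e assms(3) show ?thesis
      by (auto simp: move_edge_def card_Diff_singleton card_gt_0_iff intro!: Suc_pred)
  qed
  then show ?thesis
    using assms(1) by (auto simp: uniform_hypergraph_def move_edges_def)
qed

section \<open>The tensor of a uniform hypergraph\<close>

text \<open>The index set \<open>{i}\<close> is no hyperedge when \<open>k \<ge> 2\<close>, so only
  the degree part remains.\<close>

lemma alpha_tensor_replicate:
  assumes "uniform_hypergraph k n E" "k \<ge> 2"
  shows "alpha_tensor \<alpha> k E (replicate k i) = \<alpha> * real (degree E i)"
proof -
  have "{i} \<notin> E"
    using assms by (auto simp: uniform_hypergraph_def)
  moreover have "set (replicate k i) = {i}" "hd (replicate k i) = i"
    using assms(2) by (simp_all add: hd_replicate)
  ultimately show ?thesis
    by (simp add: alpha_tensor_def degree_tensor_def adjacency_tensor_def)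
qed

lemma alpha_tensor_support:
  assumes "uniform_hypergraph k n E" "alpha_tensor \<alpha> k E is \<noteq> 0"
  shows "card (set is) \<in> {1, k}"
proof -
  from assms(2) consider "set is = {hd is}" | "set is \<in> E"
    by (auto simp: alpha_tensor_def degree_tensor_def adjacency_tensor_def split: if_splits)
  then show ?thesis
  proof cases
    case 1
    then have "card (set is) = 1"
      by (metis card_1_singleton_iff One_nat_def)
    then show ?thesis
      by simp
  qed (use assms(1) in \<open>auto simp: uniform_hypergraph_def\<close>)
qed

text \<open>Off the diagonal the entry is \<open>1 - \<alpha>\<close> on edges and 0 elsewhere, and
  pairs \<open>i < j\<close> with \<open>{i, j} \<in> E\<close> correspond to the edges.\<close>

lemma sum_alpha_tensor_pairs:
  assumes "uniform_hypergraph 2 n E"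
  shows "(\<Sum>(i, j) | i < j \<and> j < n. 2 * alpha_tensor \<alpha> 2 E [i, j] * alpha_tensor \<alpha> 2 E [j, i]) =
    2 * (1 - \<alpha>)\<^sup>2 * card E"
proof -
  let ?Q = "{(i, j). i < j \<and> j < n}"
  have fin: "finite ?Q"
    by (rule finite_subset [of _ "{..<n} \<times> {..<n}"]) auto
  have "bij_betw (\<lambda>(i, j). {i, j}) {(i, j) \<in> ?Q. {i, j} \<in> E} E"
  proof (rule bij_betw_imageI)
    show "inj_on (\<lambda>(i, j). {i, j}) {(i, j) \<in> ?Q. {i, j} \<in> E}"
      by (auto simp: inj_on_def doubleton_eq_iff)
    show "(\<lambda>(i, j). {i, j}) ` {(i, j) \<in> ?Q. {i, j} \<in> E} = E"
    proof (intro equalityI subsetI)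
      fix e assume e: "e \<in> E"
      with assms obtain i j where ij: "e = {i, j}" "i \<noteq> j" "i < n" "j < n"
        by (auto simp: uniform_hypergraph_def card_2_iff)
      show "e \<in> (\<lambda>(i, j). {i, j}) ` {(i, j) \<in> ?Q. {i, j} \<in> E}"
      proof (cases "i < j")
        case True
        with e ij show ?thesis
          by (intro image_eqI [of _ _ "(i, j)"]) auto
      next
        case False
        with e ij show ?thesis
          by (intro image_eqI [of _ _ "(j, i)"]) (auto simp: insert_commute)
      qed
    qed auto
  qed
  then have card: "card {(i, j) \<in> ?Q. {i, j} \<in> E} = card E"
    by (rule bij_betw_same_card)
  have "(\<Sum>(i, j)\<in>?Q. 2 * alpha_tensor \<alpha> 2 E [i, j] * alpha_tensor \<alpha> 2 E [j, i]) =
      (\<Sum>(i, j)\<in>?Q. if {i, j} \<in> E then 2 * (1 - \<alpha>)\<^sup>2 else 0)"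
    by (rule sum.cong) (auto simp: alpha_tensor_def degree_tensor_def adjacency_tensor_def
        power2_eq_square insert_commute)
  also have "\<dots> = (\<Sum>z\<in>{(i, j) \<in> ?Q. {i, j} \<in> E}. 2 * (1 - \<alpha>)\<^sup>2)"
    by (rule sum.mono_neutral_cong_right) (use fin in \<open>auto split: if_splits\<close>)
  finally show ?thesis
    using card by simp
qed

lemma tensor_trace_alpha_1:
  assumes "uniform_hypergraph k n E" "k \<ge> 2"
  shows "tensor_trace k n (alpha_tensor \<alpha> k E) 1 = real (k - 1) ^ (n - 1) * (\<Sum>i<n. \<alpha> * real (degree E i))"
  unfolding tensor_trace_1 [OF assms(2)] alpha_tensor_replicate [OF assms] ..

lemma tensor_trace_alpha_2:
  assumes "uniform_hypergraph k n E" "k \<ge> 2"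
  shows "tensor_trace k n (alpha_tensor \<alpha> k E) 2 = real (k - 1) ^ (n - 1) *
    ((\<Sum>i<n. (\<alpha> * real (degree E i))\<^sup>2) + (if k = 2 then 2 * (1 - \<alpha>)\<^sup>2 * card E else 0))"
  using assms sum_alpha_tensor_pairs [of n E \<alpha>]
  by (subst tensor_trace_2) (auto simp: alpha_tensor_replicate dest: alpha_tensor_support simp del: One_nat_def)

text \<open>The conditions \<open>v \<notin> e\<close> and \<open>move_edge u v e \<notin> E\<close>
  say that the moved edges keep \<open>k\<close> vertices and create no multiple hyperedges;
  \<open>s \<ge> 1\<close> says that something is moved.\<close>

theorem lemma4p1:
  fixes k n u v s :: nat and E E' P :: "nat set set" and \<alpha> :: real
  assumes "k \<ge> 2"
    and "uniform_hypergraph k n E"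
    and "u < n" and "v < n" and "u \<noteq> v"
    and "P = {e. pendant k E e \<and> u \<in> e}"
    and "s = card P" and "s \<ge> 1"
    and "degree E u < degree E v + s"
    and "\<And>e. e \<in> P \<Longrightarrow> v \<notin> e"
    and "\<And>e. e \<in> P \<Longrightarrow> move_edge u v e \<notin> E"
    and "E' = move_edges E P u v"
    and "0 < \<alpha>" and "\<alpha> < 1"
  shows "S_alpha_less \<alpha> k n E E'"
proof -
  have fin: "finite E"
    using assms(2) by (rule uniform_hypergraph_finite)
  have sub: "P \<subseteq> E" and ends: "\<And>e. e \<in> P \<Longrightarrow> u \<in> e \<and> v \<notin> e"
    using assms by (auto simp: pendant_def)
  note moved = fin sub ends assms(11)
  have unif: "uniform_hypergraph k n E'"
    unfolding assms(12) using assms(2) sub assms(4) ends by (rule uniform_move_edges)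
  \<comment> \<open>This makes the natural-number difference \<open>degree E u - card P\<close> a
    genuine one when cast to the reals.\<close>
  have s_le: "s \<le> degree E u"
    using degree_move_edges_source [OF moved assms(5)] assms(7) by simp
  have pos: "real (k - 1) ^ (n - 1) > 0"
    using assms(1) by simp

  have "(\<Sum>i<n. \<alpha> * real (degree E' i)) = (\<Sum>i<n. \<alpha> * real (degree E i))"
    unfolding assms(12) using s_le sum_degree_move_edges [OF moved assms(3-5), of "\<lambda>d. \<alpha> * real d"]
    by (simp add: assms(7) of_nat_diff algebra_simps)
  then have tr1: "tensor_trace k n (alpha_tensor \<alpha> k E) 1 = tensor_trace k n (alpha_tensor \<alpha> k E') 1"
    by (simp only: tensor_trace_alpha_1 [OF assms(2,1)] tensor_trace_alpha_1 [OF unif assms(1)])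

  \<comment> \<open>With \<open>a\<close> and \<open>b\<close> the degrees of \<open>u\<close> and
    \<open>v\<close>, \<open>(a - s)^2 - a^2 + (b + s)^2 - b^2 = 2 s (b + s - a)\<close>.\<close>
  have "(\<Sum>i<n. (\<alpha> * real (degree E' i))\<^sup>2) =
      (\<Sum>i<n. (\<alpha> * real (degree E i))\<^sup>2) + 2 * \<alpha>\<^sup>2 * s * (real (degree E v) + s - degree E u)"
    unfolding assms(12) using s_le sum_degree_move_edges [OF moved assms(3-5), of "\<lambda>d. (\<alpha> * real d)\<^sup>2"]
    by (simp add: assms(7) of_nat_diff power2_eq_square algebra_simps)
  moreover have "2 * \<alpha>\<^sup>2 * s * (real (degree E v) + s - degree E u) > 0"
    using assms(8,9,13) by (intro mult_pos_pos) auto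
  moreover have "card E' = card E"
    unfolding assms(12) by (rule card_move_edges [OF moved])
  ultimately have tr2: "tensor_trace k n (alpha_tensor \<alpha> k E) 2 < tensor_trace k n (alpha_tensor \<alpha> k E') 2"
    unfolding tensor_trace_alpha_2 [OF assms(2,1)] tensor_trace_alpha_2 [OF unif assms(1)]
    using pos by (intro mult_strict_left_mono) auto

  \<comment> \<open>It remains to see that order 2 lies in the admissible range: a moved edge
    together with \<open>v\<close> gives \<open>k + 1\<close>, hence at least 3, vertices.\<close>
  have "P \<noteq> {}"
    using assms(7,8) by auto
  then obtain e where "e \<in> P"
    by auto
  with sub ends assms(2,4) have "insert v e \<subseteq> {..<n}" "v \<notin> e" "card e = k"
    by (auto simp: uniform_hypergraph_def)
  then have "Suc k \<le> n"
    using card_mono [of "{..<n}" "insert v e"] by (auto dest: finite_subset)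
  then have "3 \<le> n" "n \<le> n * (k - 1) ^ (n - 1)"
    using assms(1) by simp_all
  then have "2 \<le> n * (k - 1) ^ (n - 1) - 1"
    by linarith
  then have "2 \<in> {1..n * (k - 1) ^ (n - 1) - 1}"
    by simp
  \<comment> \<open>The trace of order 0 depends on \<open>k\<close> and \<open>n\<close>
    only.\<close>
  moreover have "tensor_trace k n (alpha_tensor \<alpha> k E) t = tensor_trace k n (alpha_tensor \<alpha> k E') t" if "t < 2" for t
    using that tr1 by (auto simp: less_2_cases_iff tensor_trace_def [of _ _ _ 0])
  ultimately show ?thesis
    unfolding S_alpha_less_def using tr2 by blast
qed

end
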